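(* Let $N$ be a positive integer whose trajectory under the Collatz function reaches $1$, and let $m(N)$ be the number of odd numbers in the Collatz trajectory of $N$. If $P_N(-1)=0$, then $m(N)$ is even.
   Context: The Collatz function is $c(N)=\frac{3N+1}{2}$ for $N$ odd and $c(N)=\frac N2$ for $N$ even. Let $N$ be a positive integer whose trajectory $N, c(N), c(c(N)),\dots$ reaches $1$. The total stopping time $n$ of $N$ is the least $k\ge 0$ such that the $k$-th iterate of $N$ under $c$ equals $1$. Set $c^0(N)=N$, $c^k(N)=c(c^{k-1}(N))$ for $1\le k\le n$, and $c^k(N)=0$ for $k>n$. The $N$-th Collatz polynomial is $P_N(z)=\sum_{k=0}^{n}c^k(N)z^k$. The Collatz trajectory of $N$ is the finite sequence $N, c(N),\dots,c^n(N)=1$, and $m(N)$ is the number of odd numbers in it. *)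

theory Defs
  imports "HOL-Computational_Algebra.Polynomial"
begin

definition collatz :: "nat \<Rightarrow> nat" where
  "collatz N = (if odd N then (3 * N + 1) div 2 else N div 2)"

definition reaches_one :: "nat \<Rightarrow> bool" where
  "reaches_one N \<longleftrightarrow> (\<exists>k. (collatz ^^ k) N = 1)"

(* Only meaningful if reaches_one N; otherwise LEAST is unspecified. *)
definition total_stopping_time :: "nat \<Rightarrow> nat" where
  "total_stopping_time N = (LEAST k. (collatz ^^ k) N = 1)"

definition collatz_coeff :: "nat \<Rightarrow> nat \<Rightarrow> nat" where
  "collatz_coeff N k = (if k \<le> total_stopping_time N then (collatz ^^ k) N else 0)"

definition collatz_poly :: "nat \<Rightarrow> int poly" where
  "collatz_poly N = (\<Sum>k\<le>total_stopping_time N. monom (int (collatz_coeff N k)) k)"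

(* The final term 1 is included. *)
definition collatz_trajectory :: "nat \<Rightarrow> nat list" where
  "collatz_trajectory N = map (\<lambda>k. (collatz ^^ k) N) [0..<Suc (total_stopping_time N)]"

definition num_odd :: "nat \<Rightarrow> nat" where
  "num_odd N = length (filter odd (collatz_trajectory N))"

end

theory Submission
  imports Defs
begin

text \<open>Since \<open>-1 \<equiv> 1\<close> modulo \<open>2\<close>, the alternating sum \<open>P\<^sub>N(-1)\<close> has the same parity as the plain
  sum of the trajectory, and a sum of integers is even exactly when it has an even number of odd
  terms.\<close>

theorem mainTheorem5:
  fixes N :: nat
  assumes "N > 0"
    and "reaches_one N"
    and "poly (collatz_poly N) (-1) = 0"
  shows "even (num_odd N)"
proof -
  let ?n = "total_stopping_time N"
  let ?a = "\<lambda>k. (collatz ^^ k) N"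
  have alternating: "poly (collatz_poly N) (-1) = (\<Sum>k\<le>?n. int (?a k) * (-1) ^ k)"
    by (simp add: collatz_poly_def poly_sum poly_monom collatz_coeff_def)
  have count: "num_odd N = card {k \<in> {..?n}. odd (?a k)}"
    unfolding num_odd_def collatz_trajectory_def length_filter_conv_card
    by (rule arg_cong[where f = card])
      (auto simp: less_Suc_eq_le nth_map_upt simp del: upt_Suc funpow.simps)
  have "even (\<Sum>k\<le>?n. int (?a k) * (-1) ^ k)"
    using assms(3) alternating by simp
  then have "even (card {k \<in> {..?n}. odd (int (?a k) * (-1) ^ k)})"
    by (simp only: even_sum_iff finite_atMost)
  then show ?thesis
    by (simp add: count)
qed

end
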